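(* Let $X=\mathbb{R}^k$ with the Euclidean norm $\|\cdot\|$, and let $T:X\rightrightarrows X$ be union paracontracting, i.e. $T(x)=\{T_i(x): i\in\phi(x)\}$ for all $x\in X$, where $I$ is a finite index set, each $T_i:X\to X$ ($i\in I$) is paracontracting, and $\phi:X\rightrightarrows I$ is nonempty-valued and outer semicontinuous. Let $x^*$ be a strong fixed point of $T$, i.e. $T(x^* )=\{x^*\}$, and define $$r:=\sup\{\delta>0:\phi(x)\subseteq\phi(x^* )\text{ for all }x\in\mathbb{B}(x^*;\delta)\}\in[-\infty,+\infty],$$ with the convention $\sup\emptyset=-\infty$. Then $r>0$ and, for every $\epsilon\in(0,r)$: (a) $\|y-x^*\|\leq\|x-x^*\|$ whenever $x\in\mathbb{B}(x^*;\epsilon)$ and $y\in T(x)$; (b) if $x_0\in\mathbb{B}(x^*;\epsilon)$ and $(x_n)_{n\in\mathbb{N}}$ is any sequence starting at $x_0$ with $x_{n+1}\in T(x_n)$ for all $n\in\mathbb{N}$, then $(x_n)_{n\in\mathbb{N}}$ converges to a point $\overline{x}\in\operatorname{Fix}T\cap\mathbb{B}(x^*;\epsilon)$, where $\operatorname{Fix}T=\{x\in X:x\in T(x)\}$.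
   Context: $\mathbb{B}(x^*;\delta)$ denotes the closed ball centred at $x^*$ with radius $\delta>0$. The notation $X\rightrightarrows Y$ denotes a set-valued map from $X$ to subsets of $Y$. A single-valued operator $S:X\to X$ is paracontracting if it is continuous and $\|S(x)-y\|<\|x-y\|$ for all $x\in X\setminus\operatorname{Fix}S$ and all $y\in\operatorname{Fix}S$, where $\operatorname{Fix}S=\{x\in X:S(x)=x\}$ (possibly empty). A set-valued map $\phi:X\rightrightarrows I$ into a finite set $I$ is outer semicontinuous if, for all $x\in X$, $\phi(x)\supseteq\{i\in I:\exists x_n\to x,\ \exists i_n\to i\text{ with }i_n\in\phi(x_n)\}$; here convergence $i_n\to i$ in the finite set $I$ means that $i_n=i$ for all sufficiently large $n$. *)

theory Defs
  imports "HOL-Analysis.Analysis"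
begin

definition fix_points :: "('a \<Rightarrow> 'a) \<Rightarrow> 'a set" where
  "fix_points S = {x. S x = x}"

definition set_fix_points :: "('a \<Rightarrow> 'a set) \<Rightarrow> 'a set" where
  "set_fix_points T = {x. x \<in> T x}"

definition strong_fix_point :: "('a \<Rightarrow> 'a set) \<Rightarrow> 'a \<Rightarrow> bool" where
  "strong_fix_point T x \<longleftrightarrow> T x = {x}"

definition paracontracting :: "('a::real_normed_vector \<Rightarrow> 'a) \<Rightarrow> bool" where
  "paracontracting S \<longleftrightarrow>
     continuous_on UNIV S \<and>
     (\<forall>x. x \<notin> fix_points S \<longrightarrow> (\<forall>y\<in>fix_points S. norm (S x - y) < norm (x - y)))"

text \<open>
  Set-valued maps into a finite index set \<open>I\<close>, a subset of the type \<open>'i\<close>. Convergence of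
  indices is convergence in the discrete topology, i.e. being eventually constant.
\<close>

definition outer_semicontinuous ::
    "'i set \<Rightarrow> ('a::topological_space \<Rightarrow> 'i set) \<Rightarrow> bool" where
  "outer_semicontinuous I \<phi> \<longleftrightarrow>
     (\<forall>x. {i \<in> I. \<exists>xs. xs \<longlonglongrightarrow> x \<and>
             (\<exists>is. (\<forall>\<^sub>F n in sequentially. is n = i) \<and> (\<forall>n. is n \<in> \<phi> (xs n)))}
          \<subseteq> \<phi> x)"

text \<open>
  The data \<open>I\<close>, \<open>Ts\<close>, \<open>\<phi>\<close> are explicit arguments, not existentially quantified, because
  \<open>osc_radius\<close> depends on the representation \<open>\<phi>\<close> and not only on \<open>T\<close>.
\<close>

definition union_paracontracting ::
    "'i set \<Rightarrow> ('i \<Rightarrow> 'a::real_normed_vector \<Rightarrow> 'a) \<Rightarrow> ('a \<Rightarrow> 'i set) \<Rightarrow> ('a \<Rightarrow> 'a set) \<Rightarrow> bool" where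
  "union_paracontracting I Ts \<phi> T \<longleftrightarrow>
     finite I \<and>
     (\<forall>i\<in>I. paracontracting (Ts i)) \<and>
     (\<forall>x. \<phi> x \<subseteq> I) \<and>
     (\<forall>x. \<phi> x \<noteq> {}) \<and>
     outer_semicontinuous I \<phi> \<and>
     (\<forall>x. T x = {Ts i x | i. i \<in> \<phi> x})"

text \<open>In \<^typ>\<open>ereal\<close>, the supremum of the empty set is \<open>-\<infinity>\<close>.\<close>

definition osc_radius :: "('a::real_normed_vector \<Rightarrow> 'i set) \<Rightarrow> 'a \<Rightarrow> ereal" where
  "osc_radius \<phi> x' = Sup {ereal \<delta> | \<delta>. \<delta> > 0 \<and> (\<forall>x\<in>cball x' \<delta>. \<phi> x \<subseteq> \<phi> x')}"

end

theory Submission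
  imports Defs
begin

text \<open>
  Near the strong fixed point \<open>x\<^sup>*\<close> only indices of \<open>\<phi> x\<^sup>*\<close> are active, because an index that is
  active arbitrarily close to \<open>x\<^sup>*\<close> is active at \<open>x\<^sup>*\<close> by outer semicontinuity and there are only
  finitely many indices. This gives \<open>r > 0\<close>. Each operator active at \<open>x\<^sup>*\<close> fixes \<open>x\<^sup>*\<close>, so at
  distance less than \<open>r\<close> no step increases the distance to \<open>x\<^sup>*\<close>. Hence a trajectory that starts in the closed
  \<open>\<epsilon>\<close>-ball with \<open>\<epsilon> < r\<close> never leaves it, and applies only finitely many paracontractions, all fixing \<open>x\<^sup>*\<close>.

  Such a trajectory converges however the operators are ordered. Its distances to \<open>x\<^sup>*\<close> do not increase,
  so they have a limit \<open>d\<close>, and by compactness it has a cluster point \<open>y\<close>. If an operator \<open>S\<close> is applied at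
  visits arbitrarily late and arbitrarily close to \<open>y\<close>, then continuity gives
  \<open>\<parallel>S y - x\<^sup>*\<parallel> = d = \<parallel>y - x\<^sup>*\<parallel>\<close>, which for a paracontraction forces \<open>S y = y\<close>. Now suppose that
  operators moving \<open>y\<close> were applied infinitely often. After a visit close to \<open>y\<close>, the operators
  applied before the next of these all fix \<open>y\<close> and do not increase the distance to \<open>y\<close>; so this
  next one is also applied close to \<open>y\<close>. One of the finitely many such operators is then applied at
  visits arbitrarily late and arbitrarily close to \<open>y\<close>, hence fixes \<open>y\<close>, a contradiction. So from
  some time on every applied operator fixes \<open>y\<close>, the distance to \<open>y\<close> does not increase, and it tends to
  \<open>0\<close> since \<open>y\<close> is a cluster point. Finally, some index is active at visits
  arbitrarily close to \<open>y\<close> and its operator fixes \<open>y\<close>; by outer semicontinuity it is active at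
  \<open>y\<close>, so \<open>y \<in> T y\<close>.
\<close>

section \<open>Outer semicontinuity at a point\<close>

text \<open>
  The sequences of indices in the definition are eventually constant, so outer semicontinuity only
  speaks of a single index that is active arbitrarily close to the point.
\<close>
lemma outer_semicontinuous_frequently:
  fixes \<phi> :: "'a::metric_space \<Rightarrow> 'i set"
  assumes osc: "outer_semicontinuous I \<phi>" and "i \<in> I"
    and freq: "\<exists>\<^sub>F z in nhds x. i \<in> \<phi> z"
  shows "i \<in> \<phi> x"
proof -
  have "\<exists>z. dist z x < inverse (real (Suc n)) \<and> i \<in> \<phi> z" for n
  proof -
    have "\<forall>\<^sub>F z in nhds x. dist z x < inverse (real (Suc n))"
      unfolding eventually_nhds_metric by (metis inverse_positive_iff_positive of_nat_0_less_iff zero_less_Suc)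
    then show ?thesis
      using frequently_ex[OF frequently_eventually_conj[OF freq]] by blast
  qed
  then obtain zs where zs: "\<And>n. dist (zs n) x < inverse (real (Suc n))" "\<And>n. i \<in> \<phi> (zs n)"
    by metis
  have "(\<lambda>n. dist (zs n) x) \<longlonglongrightarrow> 0"
    by (rule tendsto_sandwich[OF _ _ tendsto_const LIMSEQ_inverse_real_of_nat])
      (simp_all only: less_imp_le[OF zs(1)] zero_le_dist eventually_True)
  then have "zs \<longlonglongrightarrow> x"
    by (rule tendsto_dist_iff[THEN iffD2])
  then have "\<exists>xs. xs \<longlonglongrightarrow> x \<and> (\<exists>is. (\<forall>\<^sub>F n in sequentially. is n = i) \<and> (\<forall>n. is n \<in> \<phi> (xs n)))"
    using zs(2) by (intro exI[of _ zs] conjI exI[of _ "\<lambda>_. i"]) auto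
  then show ?thesis
    using osc[unfolded outer_semicontinuous_def, rule_format, of x] \<open>i \<in> I\<close>
    by (elim subsetD) simp
qed

lemma outer_semicontinuous_locally_subset:
  fixes \<phi> :: "'a::metric_space \<Rightarrow> 'i set"
  assumes "finite I" "outer_semicontinuous I \<phi>" "\<And>z. \<phi> z \<subseteq> I"
  shows "\<forall>\<^sub>F z in nhds x. \<phi> z \<subseteq> \<phi> x"
proof -
  have "\<forall>\<^sub>F z in nhds x. \<forall>i\<in>I - \<phi> x. i \<notin> \<phi> z"
  proof (rule eventually_ball_finite)
    show "\<forall>i\<in>I - \<phi> x. \<forall>\<^sub>F z in nhds x. i \<notin> \<phi> z"
      using outer_semicontinuous_frequently[OF assms(2)] unfolding frequently_def by blast
  qed (use assms(1) in simp)
  then show ?thesis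
    by eventually_elim (use assms(3) in blast)
qed

lemma osc_radius_pos:
  fixes \<phi> :: "'a::real_normed_vector \<Rightarrow> 'i set"
  assumes "finite I" "outer_semicontinuous I \<phi>" "\<And>z. \<phi> z \<subseteq> I"
  shows "osc_radius \<phi> x > 0"
proof -
  obtain d where d: "d > 0" "\<And>z. dist z x < d \<Longrightarrow> \<phi> z \<subseteq> \<phi> x"
    using outer_semicontinuous_locally_subset[OF assms, of x]
    unfolding eventually_nhds_metric by blast
  have "ereal (d / 2) \<le> osc_radius \<phi> x"
    unfolding osc_radius_def
  proof (intro Sup_upper CollectI exI conjI ballI)
    show "\<phi> z \<subseteq> \<phi> x" if "z \<in> cball x (d / 2)" for z
      using that d(1) by (intro d(2)) (simp add: dist_commute)
  qed (use d(1) in simp_all)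
  moreover have "0 < ereal (d / 2)"
    using d(1) by simp
  ultimately show ?thesis
    by (rule less_le_trans[rotated])
qed

lemma active_subset_below_osc_radius:
  assumes "ereal \<epsilon> < osc_radius \<phi> x" "z \<in> cball x \<epsilon>"
  shows "\<phi> z \<subseteq> \<phi> x"
proof -
  obtain d where "\<epsilon> < d" "\<forall>z\<in>cball x d. \<phi> z \<subseteq> \<phi> x"
    using assms(1) unfolding osc_radius_def less_Sup_iff by auto
  then show ?thesis
    using assms(2) by auto
qed

section \<open>Iterating finitely many paracontractions\<close>

lemma paracontracting_norm_le:
  assumes "paracontracting S" "S c = c"
  shows "norm (S x - c) \<le> norm (x - c)"
  using assms unfolding paracontracting_def fix_points_def
  by (cases "S x = x") (auto intro: less_imp_le)

lemma paracontracting_norm_eq_imp_fixed: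
  assumes "paracontracting S" "S c = c" "norm (S x - c) = norm (x - c)"
  shows "S x = x"
  using assms unfolding paracontracting_def fix_points_def by force

text \<open>
  The filter of the times that are late and at which \<open>xs\<close> is close to \<open>y\<close>. It is proper if and
  only if \<open>y\<close> is a cluster point of \<open>xs\<close>, and then replaces the choice of a subsequence.
\<close>
definition visits :: "(nat \<Rightarrow> 'a::topological_space) \<Rightarrow> 'a \<Rightarrow> nat filter" where
  "visits xs y = inf sequentially (filtercomap xs (nhds y))"

lemma visits_le_sequentially: "visits xs y \<le> sequentially"
  by (simp add: visits_def)

lemma tendsto_visits: "(xs \<longlongrightarrow> y) (visits xs y)"
  unfolding visits_def by (rule tendsto_mono[OF inf_le2 filterlim_filtercomap])

lemma eventually_visits:
  fixes xs :: "nat \<Rightarrow> 'a::metric_space"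
  shows "eventually P (visits xs y) \<longleftrightarrow> (\<exists>N. \<exists>e>0. \<forall>n\<ge>N. dist (xs n) y < e \<longrightarrow> P n)"
proof
  assume "eventually P (visits xs y)"
  then obtain Q R where "\<forall>\<^sub>F n in sequentially. Q n" "\<forall>\<^sub>F z in nhds y. R z"
    and QR: "\<And>n. Q n \<Longrightarrow> R (xs n) \<Longrightarrow> P n"
    unfolding visits_def eventually_inf eventually_filtercomap by blast
  then obtain N e where "\<And>n. n \<ge> N \<Longrightarrow> Q n" "e > 0" "\<And>z. dist z y < e \<Longrightarrow> R z"
    unfolding eventually_sequentially eventually_nhds_metric by blast
  with QR show "\<exists>N. \<exists>e>0. \<forall>n\<ge>N. dist (xs n) y < e \<longrightarrow> P n"
    by blast
next
  assume "\<exists>N. \<exists>e>0. \<forall>n\<ge>N. dist (xs n) y < e \<longrightarrow> P n"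
  then obtain N e where e: "e > 0" and P: "\<And>n. n \<ge> N \<Longrightarrow> dist (xs n) y < e \<Longrightarrow> P n"
    by blast
  have "\<forall>\<^sub>F n in visits xs y. n \<ge> N"
    by (rule filter_leD[OF visits_le_sequentially eventually_ge_at_top])
  with tendstoD[OF tendsto_visits e] show "eventually P (visits xs y)"
    by eventually_elim (rule P)
qed

lemma frequently_visits:
  fixes xs :: "nat \<Rightarrow> 'a::metric_space"
  shows "frequently P (visits xs y) \<longleftrightarrow> (\<forall>N. \<forall>e>0. \<exists>n\<ge>N. dist (xs n) y < e \<and> P n)"
  unfolding frequently_def eventually_visits by blast

lemma compact_imp_cluster_point:
  fixes xs :: "nat \<Rightarrow> 'a::metric_space"
  assumes "compact C" "\<And>n. xs n \<in> C"
  obtains y where "y \<in> C" "visits xs y \<noteq> bot"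
proof -
  obtain y s where "y \<in> C" and s: "strict_mono s" "(xs \<circ> s) \<longlonglongrightarrow> y"
    using assms unfolding compact_def by metis
  have "\<exists>\<^sub>F n in visits xs y. True"
    unfolding frequently_visits
  proof (intro allI impI)
    fix N and e :: real assume "e > 0"
    then obtain k where "\<And>m. m \<ge> k \<Longrightarrow> dist (xs (s m)) y < e"
      using s(2) unfolding lim_sequentially by auto
    then have "dist (xs (s (max N k))) y < e" by simp
    moreover have "s (max N k) \<ge> N"
      using seq_suble[OF s(1), of "max N k"] by linarith
    ultimately show "\<exists>n\<ge>N. dist (xs n) y < e \<and> True" by blast
  qed
  then have "visits xs y \<noteq> bot"
    by (simp add: frequently_def trivial_limit_def)
  with \<open>y \<in> C\<close> show thesis by (rule that)
qed

text \<open>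
  Distances to \<open>c\<close> do not increase, hence have a limit. As \<open>S\<close> is applied at visits to \<open>y\<close>, both \<open>y\<close> and
  \<open>S y\<close> are at that limit distance from \<open>c\<close>.
\<close>
lemma paracontracting_applied_at_visits_fixes:
  assumes S: "paracontracting S" "S c = c"
    and decr: "\<And>n. norm (xs (Suc n) - c) \<le> norm (xs n - c)"
    and freq: "\<exists>\<^sub>F n in visits xs y. xs (Suc n) = S (xs n)"
  shows "S y = y"
proof -
  define F where "F = inf (visits xs y) (principal {n. xs (Suc n) = S (xs n)})"
  have F_nontriv: "F \<noteq> bot"
    using freq unfolding F_def frequently_def trivial_limit_def eventually_inf_principal by simp
  have F_seq: "F \<le> sequentially"
    unfolding F_def using visits_le_sequentially by (rule le_infI1)
  have xs_F: "(xs \<longlongrightarrow> y) F"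
    using tendsto_visits by (rule tendsto_mono[rotated]) (simp add: F_def)
  have "decseq (\<lambda>n. norm (xs n - c))"
    by (rule decseq_SucI) (rule decr)
  then obtain d where d: "(\<lambda>n. norm (xs n - c)) \<longlonglongrightarrow> d"
    using decseq_convergent[of "\<lambda>n. norm (xs n - c)" 0] by auto
  have "norm (y - c) = d"
    by (rule tendsto_unique[OF F_nontriv _ tendsto_mono[OF F_seq d]])
      (intro tendsto_intros xs_F)
  moreover have "norm (S y - c) = d"
  proof (rule tendsto_unique[OF F_nontriv])
    show "((\<lambda>n. norm (xs (Suc n) - c)) \<longlongrightarrow> d) F"
      using F_seq d[THEN LIMSEQ_Suc] by (rule tendsto_mono)
    have "isCont S y"
      using S(1) by (simp add: paracontracting_def continuous_on_eq_continuous_at)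
    then have "((\<lambda>n. norm (S (xs n) - c)) \<longlongrightarrow> norm (S y - c)) F"
      by (intro tendsto_intros isCont_tendsto_compose[OF _ xs_F])
    moreover have "\<forall>\<^sub>F n in F. norm (S (xs n) - c) = norm (xs (Suc n) - c)"
      unfolding F_def eventually_inf_principal by simp
    ultimately show "((\<lambda>n. norm (xs (Suc n) - c)) \<longlongrightarrow> norm (S y - c)) F"
      by (rule Lim_transform_eventually)
  qed
  ultimately show ?thesis
    by (intro paracontracting_norm_eq_imp_fixed[OF S]) simp
qed

lemma frequently_ex_finite:
  assumes "finite A" "\<exists>\<^sub>F n in F. f n \<in> A"
  obtains a where "a \<in> A" "\<exists>\<^sub>F n in F. f n = a"
proof -
  have "(\<forall>a\<in>A. f n \<noteq> a) \<longleftrightarrow> f n \<notin> A" for n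
    by auto
  then have "\<not> (\<forall>a\<in>A. \<forall>\<^sub>F n in F. f n \<noteq> a)"
    using eventually_ball_finite[OF assms(1), of "\<lambda>n a. f n \<noteq> a" F] assms(2)
    unfolding frequently_def by auto
  then show thesis
    using that unfolding frequently_def by blast
qed

text \<open>
  Otherwise a late visit close to \<open>y\<close> would be followed by a first application of an operator
  moving \<open>y\<close>, still close to \<open>y\<close> since the operators applied in between fix \<open>y\<close>.
\<close>
lemma eventually_applied_fix_cluster_point:
  assumes "finite J" and para: "\<And>j. j \<in> J \<Longrightarrow> paracontracting (Ts j)"
    and common: "\<And>j. j \<in> J \<Longrightarrow> Ts j c = c"
    and idx: "\<And>n. idx n \<in> J" and step: "\<And>n. xs (Suc n) = Ts (idx n) (xs n)"
    and cluster: "visits xs y \<noteq> bot"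
  shows "\<forall>\<^sub>F n in sequentially. Ts (idx n) y = y"
proof (rule ccontr)
  assume "\<not> ?thesis"
  then have inf_often: "\<exists>m\<ge>n. Ts (idx m) y \<noteq> y" for n
    unfolding eventually_sequentially by blast
  let ?M = "{j\<in>J. Ts j y \<noteq> y}"
  have "\<exists>\<^sub>F n in visits xs y. idx n \<in> ?M"
    unfolding frequently_visits
  proof (intro allI impI)
    fix N and e :: real assume "e > 0"
    have "\<exists>\<^sub>F n in visits xs y. True"
      using cluster by simp
    then obtain n where n: "n \<ge> N" "dist (xs n) y < e"
      unfolding frequently_visits using \<open>e > 0\<close> by blast
    define m where "m = (LEAST m. m \<ge> n \<and> Ts (idx m) y \<noteq> y)"
    have m: "m \<ge> n" "Ts (idx m) y \<noteq> y"
      using LeastI_ex[of "\<lambda>m. m \<ge> n \<and> Ts (idx m) y \<noteq> y"] inf_often[of n]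
      unfolding m_def by blast+
    have between: "Ts (idx k) y = y" if "n \<le> k" "k < m" for k
      using not_less_Least[of k "\<lambda>m. m \<ge> n \<and> Ts (idx m) y \<noteq> y"] that unfolding m_def by blast
    have "k \<le> m \<longrightarrow> dist (xs k) y < e" if "n \<le> k" for k
      using that
    proof (induction k rule: dec_induct)
      case (step k)
      show ?case
      proof
        assume "Suc k \<le> m"
        then have "norm (xs (Suc k) - y) \<le> norm (xs k - y)"
          using between[of k] step.hyps para idx
          by (simp add: assms(5) paracontracting_norm_le)
        then show "dist (xs (Suc k)) y < e"
          using step.IH \<open>Suc k \<le> m\<close> by (simp add: dist_norm)
      qed
    qed (use n in simp)
    then show "\<exists>n\<ge>N. dist (xs n) y < e \<and> idx n \<in> ?M"
      using m n idx by (intro exI[of _ m]) auto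
  qed
  then obtain j where j: "j \<in> J" "Ts j y \<noteq> y" "\<exists>\<^sub>F n in visits xs y. idx n = j"
    using frequently_ex_finite[of ?M idx "visits xs y"] \<open>finite J\<close> by auto
  have "Ts j y = y"
  proof (rule paracontracting_applied_at_visits_fixes)
    show "\<exists>\<^sub>F n in visits xs y. xs (Suc n) = Ts j (xs n)"
      using j(3) by (rule frequently_elim1) (simp add: step)
    show "norm (xs (Suc n) - c) \<le> norm (xs n - c)" for n
      by (simp add: step paracontracting_norm_le para common idx)
  qed (use j para common in auto)
  with j(2) show False by contradiction
qed

text \<open>
  Once all applied operators fix \<open>y\<close>, the trajectory cannot move away from \<open>y\<close> again after coming
  close to it.
\<close>
lemma paracontracting_iteration_converges:
  assumes "finite J" and para: "\<And>j. j \<in> J \<Longrightarrow> paracontracting (Ts j)"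
    and "\<And>j. j \<in> J \<Longrightarrow> Ts j c = c"
    and idx: "\<And>n. idx n \<in> J" and step: "\<And>n. xs (Suc n) = Ts (idx n) (xs n)"
    and cluster: "visits xs y \<noteq> bot"
  shows "xs \<longlonglongrightarrow> y"
proof -
  obtain N where N: "\<And>n. n \<ge> N \<Longrightarrow> Ts (idx n) y = y"
    using eventually_applied_fix_cluster_point[OF assms] unfolding eventually_sequentially by blast
  have decr: "dist (xs n) y \<le> dist (xs m) y" if "N \<le> m" "m \<le> n" for m n
    using that(2)
  proof (induction n rule: dec_induct)
    case (step n)
    have "norm (xs (Suc n) - y) \<le> norm (xs n - y)"
      using N[of n] that(1) step.hyps para idx by (simp add: assms(5) paracontracting_norm_le)
    with step.IH show ?case by (simp add: dist_norm)
  qed simp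
  show ?thesis
    unfolding lim_sequentially
  proof (intro allI impI)
    fix e :: real assume "e > 0"
    have "\<exists>\<^sub>F n in visits xs y. True"
      using cluster by simp
    then obtain m where "m \<ge> N" "dist (xs m) y < e"
      unfolding frequently_visits using \<open>e > 0\<close> by blast
    then show "\<exists>m. \<forall>n\<ge>m. dist (xs n) y < e"
      using decr by (meson le_less_trans)
  qed
qed

section \<open>Local convergence for union paracontractions\<close>

lemma union_paracontractingD:
  assumes "union_paracontracting I Ts \<phi> T"
  shows "finite I" "outer_semicontinuous I \<phi>" "\<phi> x \<subseteq> I"
    and "i \<in> I \<Longrightarrow> paracontracting (Ts i)"
    and "T x = {Ts i x | i. i \<in> \<phi> x}"
  using assms by (simp_all add: union_paracontracting_def)

text \<open>
  The trajectory has a cluster point \<open>y\<close> because closed balls are compact, and so converges to \<open>y\<close>.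
  Among the finitely many operators that fix \<open>y\<close>, one is applied arbitrarily close to \<open>y\<close>; its
  index is active at \<open>y\<close> by outer semicontinuity, which makes \<open>y\<close> a fixed point of \<open>T\<close>.
\<close>
lemma union_paracontracting_iteration_converges:
  fixes Ts :: "'i \<Rightarrow> 'a::{real_normed_vector, heine_borel} \<Rightarrow> 'a"
  assumes T: "union_paracontracting I Ts \<phi> T"
    and fixes_c: "\<And>i. i \<in> \<phi> c \<Longrightarrow> Ts i c = c"
    and active: "\<And>n. \<phi> (xs n) \<subseteq> \<phi> c"
    and in_ball: "\<And>n. xs n \<in> cball c \<epsilon>"
    and step: "\<And>n. xs (Suc n) \<in> T (xs n)"
  obtains y where "y \<in> set_fix_points T" "y \<in> cball c \<epsilon>" "xs \<longlonglongrightarrow> y"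
proof -
  note fin = union_paracontractingD(1)[OF T] and osc = union_paracontractingD(2)[OF T]
    and phi = union_paracontractingD(3)[OF T] and para = union_paracontractingD(4)[OF T]
    and T_eq = union_paracontractingD(5)[OF T]
  have "\<exists>i\<in>\<phi> (xs n). xs (Suc n) = Ts i (xs n)" for n
    using step[of n] unfolding T_eq by blast
  then obtain idx where idx: "\<And>n. idx n \<in> \<phi> (xs n)" "\<And>n. xs (Suc n) = Ts (idx n) (xs n)"
    by metis
  have J: "finite (\<phi> c)" "\<And>j. j \<in> \<phi> c \<Longrightarrow> paracontracting (Ts j)" "\<And>n. idx n \<in> \<phi> c"
    using finite_subset[OF phi fin] para phi idx(1) active by blast+
  obtain y where y: "y \<in> cball c \<epsilon>" "visits xs y \<noteq> bot"
    using compact_cball in_ball by (rule compact_imp_cluster_point)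
  note iteration = J(1,2) fixes_c J(3) idx(2) y(2)
  have "\<forall>\<^sub>F n in visits xs y. Ts (idx n) y = y"
    by (rule filter_leD[OF visits_le_sequentially eventually_applied_fix_cluster_point[OF iteration]])
  then have "\<exists>\<^sub>F n in visits xs y. idx n \<in> {j\<in>\<phi> c. Ts j y = y}"
    using y(2) J(3) by (auto intro: eventually_frequently)
  then obtain j where j: "j \<in> \<phi> c" "Ts j y = y" "\<exists>\<^sub>F n in visits xs y. idx n = j"
    using frequently_ex_finite[of "{j\<in>\<phi> c. Ts j y = y}" idx "visits xs y"] J(1) by auto
  have "\<exists>\<^sub>F n in visits xs y. j \<in> \<phi> (xs n)"
    using j(3) by (rule frequently_elim1) (use idx(1) in blast)
  then have "\<exists>\<^sub>F z in nhds y. j \<in> \<phi> z"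
    using filterlim_iff[THEN iffD1, OF tendsto_visits[of xs y]] unfolding frequently_def by blast
  then have "j \<in> \<phi> y"
    using outer_semicontinuous_frequently[OF osc] j(1) phi by blast
  then have "y \<in> set_fix_points T"
    unfolding set_fix_points_def T_eq using j(2) by force
  then show thesis
    using y(1) paracontracting_iteration_converges[OF iteration] by (rule that)
qed

theorem theorem2p2:
  fixes I :: "'i set"
    and Ts :: "'i \<Rightarrow> real ^ 'k \<Rightarrow> real ^ 'k"
    and \<phi> :: "real ^ 'k \<Rightarrow> 'i set"
    and T :: "real ^ 'k \<Rightarrow> (real ^ 'k) set"
    and xstar :: "real ^ 'k"
    and r :: ereal
  assumes "union_paracontracting I Ts \<phi> T"
    and "strong_fix_point T xstar"
    and "r = osc_radius \<phi> xstar"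
  shows "r > 0 \<and>
    (\<forall>\<epsilon>::real. 0 < \<epsilon> \<and> ereal \<epsilon> < r \<longrightarrow>
      (\<forall>x\<in>cball xstar \<epsilon>. \<forall>y\<in>T x. norm (y - xstar) \<le> norm (x - xstar)) \<and>
      (\<forall>xs :: nat \<Rightarrow> real ^ 'k.
         xs 0 \<in> cball xstar \<epsilon> \<and> (\<forall>n. xs (Suc n) \<in> T (xs n)) \<longrightarrow>
         (\<exists>xbar \<in> set_fix_points T \<inter> cball xstar \<epsilon>. xs \<longlonglongrightarrow> xbar)))"
proof (intro conjI allI impI)
  note fin = union_paracontractingD(1)[OF assms(1)] and osc = union_paracontractingD(2)[OF assms(1)]
    and phi = union_paracontractingD(3)[OF assms(1)] and para = union_paracontractingD(4)[OF assms(1)]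
    and T_eq = union_paracontractingD(5)[OF assms(1)]
  show "r > 0"
    unfolding assms(3) using fin osc phi by (rule osc_radius_pos)
  have fixes_xstar: "Ts i xstar = xstar" if "i \<in> \<phi> xstar" for i
  proof -
    have "Ts i xstar \<in> T xstar"
      unfolding T_eq using that by blast
    then show ?thesis
      using assms(2) by (simp add: strong_fix_point_def)
  qed
  fix \<epsilon> :: real assume "0 < \<epsilon> \<and> ereal \<epsilon> < r"
  then have active: "\<phi> x \<subseteq> \<phi> xstar" if "x \<in> cball xstar \<epsilon>" for x
    using active_subset_below_osc_radius that unfolding assms(3) by blast
  show nonexp: "\<forall>x\<in>cball xstar \<epsilon>. \<forall>y\<in>T x. norm (y - xstar) \<le> norm (x - xstar)"
  proof (intro ballI)
    fix x y assume x: "x \<in> cball xstar \<epsilon>" and "y \<in> T x"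
    then obtain i where "i \<in> \<phi> x" "y = Ts i x"
      unfolding T_eq by blast
    then show "norm (y - xstar) \<le> norm (x - xstar)"
      using active[OF x] para phi fixes_xstar by (blast intro: paracontracting_norm_le)
  qed
  fix xs :: "nat \<Rightarrow> real ^ 'k"
  assume xs: "xs 0 \<in> cball xstar \<epsilon> \<and> (\<forall>n. xs (Suc n) \<in> T (xs n))"
  have in_ball: "xs n \<in> cball xstar \<epsilon>" for n
  proof (induction n)
    case (Suc n)
    then have "norm (xs (Suc n) - xstar) \<le> norm (xs n - xstar)"
      using nonexp xs by blast
    then show ?case
      using Suc by (simp add: dist_norm norm_minus_commute)
  qed (use xs in blast)
  have step: "xs (Suc n) \<in> T (xs n)" for n
    using xs by blast
  obtain y where "y \<in> set_fix_points T" "y \<in> cball xstar \<epsilon>" "xs \<longlonglongrightarrow> y"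
    using assms(1) fixes_xstar active[OF in_ball] in_ball step
    by (rule union_paracontracting_iteration_converges)
  then show "\<exists>xbar \<in> set_fix_points T \<inter> cball xstar \<epsilon>. xs \<longlonglongrightarrow> xbar"
    by blast
qed

end
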